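(* Let $G\le S_n$. Then $\overline{\mathrm{Lex}_G}=\mathrm{SS}_G$.
   Context: A permutation $g\in S_n$ acts on $\mathbb{R}^n$ by $gx:=(x_{g^{-1}(i)})_{i=1}^n$. $\succeq$ is the lexicographic order on $\mathbb{R}^n$: $y\succ x$ iff there is $j\in[n]$ with $y_j>x_j$ and $y_i=x_i$ for all $i<j$; $y\succeq x$ iff $y\succ x$ or $y=x$. $\mathrm{Lex}_G:=\{x\in\mathbb{R}^n: x\succeq gx\ \forall g\in G\}$ and $\overline{\mathrm{Lex}_G}$ is its closure. Define the chain of pointwise stabilizers $G^0:=G$ and $G^i:=\{g\in G^{i-1}: g(i)=i\}$ for $i\in[n]$, and let $\mathrm{Orb}_{G^{i-1}}(i)=\{g(i):g\in G^{i-1}\}$. The Schreier–Sims polyhedron is $\mathrm{SS}_G:=\{x\in\mathbb{R}^n: x_i\ge x_j \text{ for all } i\in[n],\ j\in\mathrm{Orb}_{G^{i-1}}(i)\}$. *)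

theory Defs
  imports "HOL-Analysis.Analysis" "HOL-Algebra.Sym_Groups"
begin

text \<open>
  A vector of \<open>\<real>\<^sup>n\<close> is an extensional function on \<open>{1..n}\<close>, i.e. an element of
  \<open>{1..n} \<rightarrow>\<^sub>E UNIV\<close>. This set is the carrier of the finite product topology
  \<open>powertop_real {1..n}\<close>, which is the usual topology of \<open>\<real>\<^sup>n\<close>.
\<close>

definition perm_act :: "nat \<Rightarrow> (nat \<Rightarrow> nat) \<Rightarrow> (nat \<Rightarrow> real) \<Rightarrow> (nat \<Rightarrow> real)" where
  "perm_act n g x = (\<lambda>i\<in>{1..n}. x (inv' g i))"

definition lex_gt :: "nat \<Rightarrow> (nat \<Rightarrow> real) \<Rightarrow> (nat \<Rightarrow> real) \<Rightarrow> bool" where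
  "lex_gt n y x \<longleftrightarrow> (\<exists>j\<in>{1..n}. y j > x j \<and> (\<forall>i\<in>{1..n}. i < j \<longrightarrow> y i = x i))"

definition lex_ge :: "nat \<Rightarrow> (nat \<Rightarrow> real) \<Rightarrow> (nat \<Rightarrow> real) \<Rightarrow> bool" where
  "lex_ge n y x \<longleftrightarrow> lex_gt n y x \<or> y = x"

definition Lex :: "nat \<Rightarrow> (nat \<Rightarrow> nat) set \<Rightarrow> (nat \<Rightarrow> real) set" where
  "Lex n G = {x \<in> {1..n} \<rightarrow>\<^sub>E UNIV. \<forall>g\<in>G. lex_ge n x (perm_act n g x)}"

primrec stab_chain :: "(nat \<Rightarrow> nat) set \<Rightarrow> nat \<Rightarrow> (nat \<Rightarrow> nat) set" where
  "stab_chain G 0 = G"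
| "stab_chain G (Suc i) = {g \<in> stab_chain G i. g (Suc i) = Suc i}"

definition Orb :: "(nat \<Rightarrow> nat) set \<Rightarrow> nat \<Rightarrow> nat set" where
  "Orb H i = {g i | g. g \<in> H}"

definition SS :: "nat \<Rightarrow> (nat \<Rightarrow> nat) set \<Rightarrow> (nat \<Rightarrow> real) set" where
  "SS n G = {x \<in> {1..n} \<rightarrow>\<^sub>E UNIV. \<forall>i\<in>{1..n}. \<forall>j\<in>Orb (stab_chain G (i - 1)) i. x i \<ge> x j}"

end

theory Submission
  imports Defs
begin

text \<open>
  If \<open>x\<close> is lexicographically maximal in its orbit and \<open>g\<close> fixes \<open>1, \<dots>, i - 1\<close>, then \<open>x\<close> and
  \<open>g\<^sup>-\<^sup>1x\<close> agree before position \<open>i\<close>, so \<open>x\<^sub>i \<ge> x\<^bsub>g(i)\<^esub>\<close>; since \<open>SS\<close> is closed, one inclusion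
  follows. Conversely, for \<open>x\<close> in \<open>SS\<close> and \<open>e > 0\<close> the perturbation \<open>x\<^sub>i - e i\<close> lies in \<open>Lex\<close>: if
  \<open>i\<close> is the first point moved by \<open>g\<^sup>-\<^sup>1\<close>, then \<open>g\<^sup>-\<^sup>1(i) > i\<close>, so the weak inequality
  \<open>x\<^sub>i \<ge> x\<^bsub>g\<^sup>-\<^sup>1(i)\<^esub>\<close> becomes strict. Now let \<open>e\<close> tend to \<open>0\<close>.
\<close>

lemma mem_stab_chain_iff:
  "g \<in> stab_chain G i \<longleftrightarrow> g \<in> G \<and> (\<forall>k\<in>{1..i}. g k = k)"
  by (induction i) (auto simp: le_Suc_eq)

text \<open>Trades orbit points for the group elements that realise them, so that an argument can
  start from a given \<open>g\<close>.\<close>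

lemma mem_SS_iff:
  "x \<in> SS n G \<longleftrightarrow> x \<in> {1..n} \<rightarrow>\<^sub>E UNIV \<and>
    (\<forall>i\<in>{1..n}. \<forall>g\<in>G. (\<forall>k. 1 \<le> k \<and> k < i \<longrightarrow> g k = k) \<longrightarrow> x (g i) \<le> x i)"
proof -
  have "(\<forall>k\<in>{1..i - 1}. g k = k) \<longleftrightarrow> (\<forall>k. 1 \<le> k \<and> k < i \<longrightarrow> g k = k)"
    if "i \<in> {1..n}" for i and g :: "nat \<Rightarrow> nat"
    using that by (metis One_nat_def Suc_pred' atLeastAtMost_iff less_Suc_eq_le less_le_trans zero_less_one)
  then show ?thesis
    unfolding SS_def Orb_def mem_stab_chain_iff by blast
qed

lemma subgroup_sym_group_permutes:
  assumes "subgroup G (sym_group n)" "g \<in> G"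
  shows "g permutes {1..n}"
  using subgroup.mem_carrier[OF assms] by (simp add: sym_group_carrier)

lemma subgroup_sym_group_inv_closed:
  assumes "subgroup G (sym_group n)" "g \<in> G"
  shows "inv' g \<in> G"
  using subgroup.m_inv_closed[OF assms] subgroup.mem_carrier[OF assms]
  by (simp add: sym_group_inv_equality)

text \<open>The first position where \<open>y\<close> and \<open>x\<close> differ cannot precede
  \<open>i\<close>. If it is \<open>i\<close>, the inequality is strict; if it is later or absent,
  there is equality at \<open>i\<close>.\<close>

lemma lex_ge_imp_first_le:
  assumes "lex_ge n y x" "i \<in> {1..n}" "\<And>k. 1 \<le> k \<Longrightarrow> k < i \<Longrightarrow> y k = x k"
  shows "x i \<le> y i"
  using assms unfolding lex_ge_def lex_gt_def
  by (metis atLeastAtMost_iff less_irrefl less_imp_le linorder_neqE_nat order_refl)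

lemma Lex_subset_SS:
  assumes G: "subgroup G (sym_group n)"
  shows "Lex n G \<subseteq> SS n G"
proof
  fix x assume x: "x \<in> Lex n G"
  have "x (g i) \<le> x i"
    if i: "i \<in> {1..n}" and g: "g \<in> G" and fixed: "\<forall>k. 1 \<le> k \<and> k < i \<longrightarrow> g k = k" for i g
  proof -
    have "bij g"
      using subgroup_sym_group_permutes[OF G g] by (rule permutes_bij)
    \<comment> \<open>The action reads coordinates through the inverse, so acting with
      \<open>inv' g\<close> produces \<open>x (g k)\<close>.\<close>
    then have act: "perm_act n (inv' g) x k = x (g k)" if "k \<in> {1..n}" for k
      using that by (simp add: perm_act_def inv_inv_eq)
    have "lex_ge n x (perm_act n (inv' g) x)"
      using x subgroup_sym_group_inv_closed[OF G g] by (auto simp: Lex_def)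
    then have "perm_act n (inv' g) x i \<le> x i"
      by (rule lex_ge_imp_first_le[OF _ i]) (use act fixed i in auto)
    then show ?thesis
      by (simp add: act[OF i])
  qed
  then show "x \<in> SS n G"
    using x by (simp add: mem_SS_iff Lex_def)
qed

text \<open>An intersection of closed half-spaces, each a preimage of \<open>{..0}\<close> under a
  difference of two coordinate projections.\<close>

lemma closedin_SS:
  assumes G: "subgroup G (sym_group n)"
  shows "closedin (powertop_real {1..n}) (SS n G)"
proof -
  let ?X = "powertop_real {1..n}"
  have closed: "closedin ?X {x \<in> topspace ?X. x j \<le> x i}"
    if "i \<in> {1..n}" "j \<in> {1..n}" for i j
  proof -
    have "continuous_map ?X euclideanreal (\<lambda>x. x j - x i)"
      using that by (intro continuous_map_diff continuous_map_product_projection)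
    then have "closedin ?X {x \<in> topspace ?X. x j - x i \<in> {..0}}"
      by (rule closedin_continuous_map_preimage) simp
    then show ?thesis
      by simp
  qed
  define P where "P = (SIGMA i:{1..n}. Orb (stab_chain G (i - 1)) i)"
  have P: "i \<in> {1..n} \<and> j \<in> {1..n}" if "(i, j) \<in> P" for i j
  proof -
    have "i \<in> {1..n}" and "\<exists>g\<in>G. j = g i"
      using that by (auto simp: P_def Orb_def mem_stab_chain_iff)
    then show ?thesis
      using permutes_in_image[OF subgroup_sym_group_permutes[OF G]] by blast
  qed
  \<comment> \<open>Inserting the whole space keeps the family nonempty, and its intersection inside
    the space, even for \<open>n = 0\<close>, where \<open>P\<close> is empty.\<close>
  define F where "F = insert (topspace ?X) ((\<lambda>(i, j). {x \<in> topspace ?X. x j \<le> x i}) ` P)"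
  have "closedin ?X S" if "S \<in> F" for S
  proof -
    from that consider "S = topspace ?X"
      | i j where "(i, j) \<in> P" "S = {x \<in> topspace ?X. x j \<le> x i}"
      unfolding F_def by blast
    then show ?thesis
      by cases (use P closed in \<open>simp_all only: closedin_topspace\<close>)
  qed
  then have "closedin ?X (\<Inter>F)"
    by (intro closedin_Inter) (auto simp: F_def)
  moreover have "\<Inter>F = SS n G"
    by (auto simp: F_def P_def SS_def)
  ultimately show ?thesis
    by simp
qed

lemma perturbed_SS_in_Lex:
  assumes G: "subgroup G (sym_group n)" and x: "x \<in> SS n G" and e: "e > 0"
  shows "(\<lambda>i\<in>{1..n}. x i - e * real i) \<in> Lex n G"
proof -
  define y where "y = (\<lambda>i\<in>{1..n}. x i - e * real i)"
  have "lex_ge n y (perm_act n g y)" if g: "g \<in> G" for g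
  proof (cases "\<exists>i. inv' g i \<noteq> i")
    case False
    then have "perm_act n g y = y"
      by (auto simp: perm_act_def y_def)
    then show ?thesis
      by (simp add: lex_ge_def)
  next
    case True
    define h where "h = inv' g"
    have h: "h \<in> G" "h permutes {1..n}"
      using subgroup_sym_group_inv_closed[OF G g] subgroup_sym_group_permutes[OF G]
      by (auto simp: h_def)
    define i where "i = (LEAST i. h i \<noteq> i)"
    have moved: "h i \<noteq> i"
      using True unfolding i_def h_def by (rule LeastI_ex)
    have fixed: "h k = k" if "k < i" for k
      using that not_less_Least unfolding i_def by blast
    have i: "i \<in> {1..n}"
      using moved h(2) by (meson permutes_not_in)
    have hi: "h i \<in> {1..n}"
      using i h(2) by (simp only: permutes_in_image)
    \<comment> \<open>If \<open>h i < i\<close>, then \<open>h\<close> fixes \<open>h i\<close> by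
      minimality of \<open>i\<close>, and injectivity gives \<open>h i = i\<close>.\<close>
    have "\<not> h i < i"
      using fixed moved permutes_inj[OF h(2)] by (metis injD)
    then have "i < h i"
      using moved by simp
    \<comment> \<open>\<open>h\<close> fixes every point before \<open>i\<close>, so
      \<open>h i\<close> lies in the orbit that \<open>SS\<close> compares with
      \<open>i\<close>.\<close>
    moreover have "x (h i) \<le> x i"
      using x i h(1) fixed by (simp add: mem_SS_iff)
    moreover have "e * real i < e * real (h i)"
      using e \<open>i < h i\<close> by simp
    ultimately have "y (h i) < y i"
      using i hi by (simp add: y_def)
    then have "lex_gt n y (perm_act n g y)"
      unfolding lex_gt_def using i fixed
      by (intro bexI[of _ i]) (auto simp: perm_act_def simp flip: h_def)
    then show ?thesis
      by (simp add: lex_ge_def)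
  qed
  then show ?thesis
    by (simp add: Lex_def flip: y_def) (simp add: y_def)
qed

lemma SS_subset_closure_Lex:
  assumes G: "subgroup G (sym_group n)"
  shows "SS n G \<subseteq> powertop_real {1..n} closure_of Lex n G"
proof
  fix x assume x: "x \<in> SS n G"
  \<comment> \<open>The perturbation size \<open>1 / (k + 1)\<close> is positive for every
    \<open>k\<close>, including 0, and tends to 0.\<close>
  define y where "y k = (\<lambda>i\<in>{1..n}. x i - inverse (real (Suc k)) * real i)" for k
  have y: "y k \<in> powertop_real {1..n} closure_of Lex n G" for k
  proof -
    have "y k \<in> Lex n G"
      unfolding y_def by (rule perturbed_SS_in_Lex[OF G x]) simp
    moreover have "Lex n G \<subseteq> topspace (powertop_real {1..n})"
      by (auto simp: Lex_def)
    ultimately show ?thesis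
      using closure_of_subset by blast
  qed
  have "limitin (powertop_real {1..n}) y x sequentially"
  proof -
    have "(\<lambda>k. y k i) \<longlonglongrightarrow> x i" if "i \<in> {1..n}" for i
    proof -
      have "(\<lambda>k. x i - inverse (real (Suc k)) * real i) \<longlonglongrightarrow> x i - 0 * real i"
        by (intro tendsto_intros LIMSEQ_inverse_real_of_nat)
      then show ?thesis
        using that by (simp add: y_def)
    qed
    then show ?thesis
      using x by (auto simp: limitin_componentwise SS_def y_def PiE_iff)
  qed
  then show "x \<in> powertop_real {1..n} closure_of Lex n G"
    by (rule limitin_closedin) (simp_all add: y del: One_nat_def)
qed

theorem theorem4:
  fixes n :: nat and G :: "(nat \<Rightarrow> nat) set"
  assumes "subgroup G (sym_group n)"
  shows "powertop_real {1..n} closure_of Lex n G = SS n G"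
  using closure_of_minimal[OF Lex_subset_SS closedin_SS] SS_subset_closure_Lex assms
  by blast

end
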